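(* Let $S$ be a gluing of $S_1$ and $S_2$, namely $S=\langle qm_1,\ldots,qm_d,pn_1,\ldots,pn_k\rangle$, let $s\in S_1$ and $n=\min\{n\in\mathbb N: np\notin \mathrm{AP}(S_1,s)\}$. Then the following statements are equivalent. (1) $\mathrm{AP}(S,qs)$ is homogeneous. (2) $\mathrm{AP}(S_1,s)$ and $\mathrm{AP}(S_2,nq)$ are homogeneous, and if $n>1$, then $\mathrm{ord}_{S_1}(p)=\mathrm{ord}_{S_2}(q)$.
   Context: $\mathbb N$ contains $0$. A numerical semigroup is a submonoid of $(\mathbb N,+)$ with finite complement. $S_1$ and $S_2$ are numerical semigroups minimally generated by $m_1<\cdots<m_d$ and $n_1<\cdots<n_k$, respectively; $p\in S_1$ and $q\in S_2$ are positive integers with $\gcd(p,q)=1$, $p\notin\{m_1,\ldots,m_d\}$, $q\notin\{n_1,\ldots,n_k\}$. The numerical semigroup $S=\langle qm_1,\ldots,qm_d,pn_1,\ldots,pn_k\rangle$ is called a gluing of $S_1$ and $S_2$ (the listed generators are its minimal generators). For a numerical semigroup $H$ with minimal generators $h_1,\ldots,h_r$: a factorization of $x\in H$ is $\mathbf a\in\mathbb N^r$ with $\sum a_ih_i=x$, of length $\sum_i a_i$; $\mathrm{ord}_H(x)$ is the maximal length of a factorization of $x$; $\mathrm{AP}(H,y)=\{x\in H:x-y\notin H\}$ for $y\in H$; a subset $T\subset H$ is homogeneous if for each $0\neq x\in T$ all factorizations of $x$ have the same length (the empty set is homogeneous). *)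

theory Defs
  imports HOL.Hull "HOL-Library.FuncSet"
begin

definition submonoid_nat :: "nat set \<Rightarrow> bool" where
  "submonoid_nat H \<longleftrightarrow> 0 \<in> H \<and> (\<forall>x\<in>H. \<forall>y\<in>H. x + y \<in> H)"

definition numerical_semigroup :: "nat set \<Rightarrow> bool" where
  "numerical_semigroup H \<longleftrightarrow> submonoid_nat H \<and> finite (- H)"

definition generated :: "nat set \<Rightarrow> nat set" where
  "generated G = submonoid_nat hull G"

definition minimally_generates :: "nat set \<Rightarrow> nat set \<Rightarrow> bool" where
  "minimally_generates G H \<longleftrightarrow> generated G = H \<and> (\<forall>G'. G' \<subset> G \<longrightarrow> generated G' \<noteq> H)"

text \<open>The definite description is justified by the uniqueness lemma
  \<open>minimally_generates_unique\<close> below.\<close>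

definition min_gens :: "nat set \<Rightarrow> nat set" where
  "min_gens H = (THE G. minimally_generates G H)"

text \<open>A vector of exponents is indexed by the minimal generators themselves instead of by their
  positions, i.e. it is a function on \<open>min_gens H\<close> (extensional outside).\<close>

definition factorizations :: "nat set \<Rightarrow> nat \<Rightarrow> (nat \<Rightarrow> nat) set" where
  "factorizations H x = {a \<in> min_gens H \<rightarrow>\<^sub>E UNIV. (\<Sum>h\<in>min_gens H. a h * h) = x}"

definition fact_length :: "nat set \<Rightarrow> (nat \<Rightarrow> nat) \<Rightarrow> nat" where
  "fact_length H a = (\<Sum>h\<in>min_gens H. a h)"

definition ord_sg :: "nat set \<Rightarrow> nat \<Rightarrow> nat" where
  "ord_sg H x = Max (fact_length H ` factorizations H x)"

text \<open>The difference is taken in the integers: for \<open>x < y\<close> it is negative, hence not in \<open>H\<close>.\<close>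

definition AP :: "nat set \<Rightarrow> nat \<Rightarrow> nat set" where
  "AP H y = {x \<in> H. int x - int y \<notin> int ` H}"

definition homogeneous :: "nat set \<Rightarrow> nat set \<Rightarrow> bool" where
  "homogeneous H T \<longleftrightarrow>
     (\<forall>x\<in>T. x \<noteq> 0 \<longrightarrow>
        (\<forall>a\<in>factorizations H x. \<forall>b\<in>factorizations H x. fact_length H a = fact_length H b))"

lemma generated_least:
  assumes "G \<subseteq> K" "submonoid_nat K"
  shows "generated G \<subseteq> K"
  unfolding generated_def using assms by (rule hull_minimal)

lemma submonoid_nat_generated: "submonoid_nat (generated G)"
  unfolding generated_def by (rule hull_in) (auto simp: submonoid_nat_def)

lemma subset_generated: "G \<subseteq> generated G"
  unfolding generated_def by (rule hull_subset)

lemma submonoid_nat_bounded: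
  assumes "submonoid_nat R"
  shows "submonoid_nat {y. y < c \<longrightarrow> y \<in> R}"
  using assms unfolding submonoid_nat_def
  by (metis (mono_tags, lifting) add_leD1 add_leD2 le_add1 le_add2 mem_Collect_eq order_le_less_trans)

lemma minimally_generates_subset:
  assumes min: "minimally_generates G H" and gen: "generated G' = H"
  shows "G \<subseteq> G'"
proof
  fix x assume x: "x \<in> G"
  let ?R = "generated (G - {x})"
  have R: "submonoid_nat ?R" by (rule submonoid_nat_generated)
  have GR: "G - {x} \<subseteq> ?R" by (rule subset_generated)
  have GH: "generated G = H" using min by (simp add: minimally_generates_def)
  show "x \<in> G'"
  proof (rule ccontr)
    assume x': "x \<notin> G'"
    have "G \<subseteq> {y. y < x \<longrightarrow> y \<in> ?R}" using GR by blast
    then have below: "H \<subseteq> {y. y < x \<longrightarrow> y \<in> ?R}"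
      using generated_least submonoid_nat_bounded[OF R] GH by metis
    have "x \<in> H" using x GH subset_generated[of G] by blast
    have "G' \<subseteq> H" using gen subset_generated[of G'] by simp
    have "G' \<subseteq> {y. y < Suc x \<longrightarrow> y \<in> ?R}"
    proof
      fix y assume "y \<in> G'"
      then have "y \<noteq> x" "y < x \<longrightarrow> y \<in> ?R" using x' below \<open>G' \<subseteq> H\<close> by blast+
      then show "y \<in> {y. y < Suc x \<longrightarrow> y \<in> ?R}" by (simp add: less_Suc_eq)
    qed
    then have "H \<subseteq> {y. y < Suc x \<longrightarrow> y \<in> ?R}"
      using generated_least submonoid_nat_bounded[OF R] gen by metis
    then have "x \<in> ?R" using \<open>x \<in> H\<close> by blast
    then have "G \<subseteq> ?R" using GR by blast
    then have "H \<subseteq> ?R" using generated_least[OF _ R] GH by metis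
    moreover have "?R \<subseteq> H"
      using generated_least[of "G - {x}" "generated G"] subset_generated[of G]
        submonoid_nat_generated[of G] GH by blast
    ultimately have "?R = H" by (rule subset_antisym[rotated])
    moreover have "G - {x} \<subset> G" using x by blast
    ultimately show False using min by (simp add: minimally_generates_def)
  qed
qed

lemma minimally_generates_unique:
  assumes "minimally_generates G H" "minimally_generates G' H"
  shows "G = G'"
proof
  show "G \<subseteq> G'"
    using assms by (intro minimally_generates_subset) (auto simp: minimally_generates_def)
  show "G' \<subseteq> G"
    using assms by (intro minimally_generates_subset) (auto simp: minimally_generates_def)
qed

lemma min_gens_eq: "minimally_generates G H \<Longrightarrow> min_gens H = G"
  unfolding min_gens_def by (rule the_equality) (auto dest: minimally_generates_unique)

end

theory Submission
  imports Defs
begin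

text \<open>
  Every element of \<open>S\<close> has the form \<open>q x + p y\<close> with \<open>x \<in> S1\<close>, \<open>y \<in> S2\<close>, and since \<open>p\<close> and \<open>q\<close> are
  coprime, two such representations differ by trading \<open>x, y + t q\<close> for \<open>x + t p, y\<close>. Because the
  minimal generators of \<open>S\<close> split into two disjoint scaled copies, the lengths of an element of \<open>S\<close>
  are the sums of a length of \<open>x\<close> and a length of \<open>y\<close> over all its representations. Multiplication
  by \<open>q\<close> and \<open>p\<close> embeds \<open>AP(S1, s)\<close> and \<open>AP(S2, n q)\<close> into \<open>AP(S, q s)\<close>, and conversely every
  representation of an element of \<open>AP(S, q s)\<close> has its components in these two sets. A trade with
  \<open>t > 0\<close> inside \<open>AP(S, q s)\<close> is possible only for \<open>t < n\<close>, and it preserves the length exactly when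
  \<open>p\<close> and \<open>q\<close> have the same order.
\<close>

section \<open>Atoms and minimal generators\<close>

text \<open>The irreducible elements. For a submonoid they are its only minimal generating set,
  which turns minimality into a condition on single elements.\<close>

definition atoms :: "nat set \<Rightarrow> nat set" where
  "atoms H = {g \<in> H. g \<noteq> 0 \<and> (\<forall>u\<in>H. \<forall>v\<in>H. g = u + v \<longrightarrow> u = 0 \<or> v = 0)}"

lemma atomsD: "g \<in> atoms H \<Longrightarrow> u \<in> H \<Longrightarrow> v \<in> H \<Longrightarrow> g = u + v \<Longrightarrow> u = 0 \<or> v = 0"
  by (auto simp: atoms_def)

lemma submonoid_natD:
  assumes "submonoid_nat H"
  shows "0 \<in> H" "x \<in> H \<Longrightarrow> y \<in> H \<Longrightarrow> x + y \<in> H"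
  using assms by (auto simp: submonoid_nat_def)

lemma submonoid_nat_mult: "submonoid_nat H \<Longrightarrow> x \<in> H \<Longrightarrow> t * x \<in> H"
  by (induction t) (auto simp: submonoid_nat_def)

lemma submonoid_nat_sum: "submonoid_nat H \<Longrightarrow> (\<And>i. i \<in> I \<Longrightarrow> f i \<in> H) \<Longrightarrow> sum f I \<in> H"
  by (induction I rule: infinite_finite_induct) (auto simp: submonoid_nat_def)

text \<open>Removing an atom \<open>g\<close> from \<open>H\<close> leaves a submonoid, because two
  elements with sum \<open>g\<close> are \<open>0\<close> and \<open>g\<close>. Hence no generating
  set can omit \<open>g\<close>.\<close>

lemma minimally_generatesI_atoms:
  assumes gen: "generated G = H" and G: "G \<subseteq> atoms H"
  shows "minimally_generates G H"
  unfolding minimally_generates_def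
proof (intro conjI allI impI gen)
  fix G' assume G': "G' \<subset> G"
  then obtain g where g: "g \<in> G" "g \<notin> G'" by blast
  have H: "submonoid_nat H" using gen submonoid_nat_generated by blast
  have atom: "g \<in> atoms H" using g G by blast
  have "submonoid_nat (H - {g})"
    unfolding submonoid_nat_def
  proof (intro conjI ballI)
    show "0 \<in> H - {g}" using submonoid_natD[OF H] atom by (auto simp: atoms_def)
    fix x y assume xy: "x \<in> H - {g}" "y \<in> H - {g}"
    then have "x + y \<noteq> g" using atomsD[OF atom, of x y] by auto
    then show "x + y \<in> H - {g}" using xy submonoid_natD[OF H] by auto
  qed
  moreover have "G' \<subseteq> H - {g}" using G' G g by (auto simp: atoms_def)
  ultimately have "generated G' \<subseteq> H - {g}" by (intro generated_least)
  then show "generated G' \<noteq> H" using g gen subset_generated[of G] by blast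
qed

text \<open>Strong induction: a nonzero element that is not an atom splits into two smaller elements
  of \<open>H\<close>.\<close>

lemma generated_atoms:
  assumes "submonoid_nat H"
  shows "generated (atoms H) = H"
proof
  show "generated (atoms H) \<subseteq> H"
    using assms by (intro generated_least) (auto simp: atoms_def)
  have "x \<in> H \<Longrightarrow> x \<in> generated (atoms H)" for x
  proof (induction x rule: less_induct)
    case (less x)
    note R = submonoid_natD[OF submonoid_nat_generated[of "atoms H"]]
    consider "x = 0" | "x \<in> atoms H" | u v where "u \<in> H" "v \<in> H" "x = u + v" "u \<noteq> 0" "v \<noteq> 0"
      using less.prems by (auto simp: atoms_def)
    then show ?case
    proof cases
      case 1 then show ?thesis using R by simp
    next
      case 2 then show ?thesis using subset_generated by blast
    next
      case 3 then show ?thesis using R less.IH[of u] less.IH[of v] by simp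
    qed
  qed
  then show "H \<subseteq> generated (atoms H)" by blast
qed

lemma minimally_generates_imp_atoms:
  assumes "minimally_generates G H"
  shows "G = atoms H"
proof -
  have "submonoid_nat H"
    using assms submonoid_nat_generated by (auto simp: minimally_generates_def)
  then have "minimally_generates (atoms H) H"
    by (intro minimally_generatesI_atoms generated_atoms subset_refl)
  with assms show ?thesis by (rule minimally_generates_unique)
qed

section \<open>Sets of lengths\<close>

text \<open>Coefficients are arbitrary functions instead of extensional ones; values outside
  \<open>G\<close> do not affect the sums, and scaled or added vectors need no restriction.\<close>

definition lengths :: "nat set \<Rightarrow> nat \<Rightarrow> nat set" where
  "lengths G x = {l. \<exists>a. (\<Sum>g\<in>G. a g * g) = x \<and> (\<Sum>g\<in>G. a g) = l}"

lemma lengthsI: "(\<Sum>g\<in>G. a g * g) = x \<Longrightarrow> (\<Sum>g\<in>G. a g) = l \<Longrightarrow> l \<in> lengths G x"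
  by (auto simp: lengths_def)

lemma lengths_add:
  assumes "l \<in> lengths G x" "l' \<in> lengths G x'"
  shows "l + l' \<in> lengths G (x + x')"
proof -
  obtain a a' where "(\<Sum>g\<in>G. a g * g) = x" "(\<Sum>g\<in>G. a g) = l"
    "(\<Sum>g\<in>G. a' g * g) = x'" "(\<Sum>g\<in>G. a' g) = l'"
    using assms by (auto simp: lengths_def)
  then show ?thesis
    by (intro lengthsI[where a = "\<lambda>g. a g + a' g"]) (auto simp: sum.distrib algebra_simps)
qed

lemma zero_in_lengths: "0 \<in> lengths G 0"
  by (rule lengthsI[where a = "\<lambda>_. 0"]) auto

lemma lengths_mult: "l \<in> lengths G x \<Longrightarrow> t * l \<in> lengths G (t * x)"
  by (induction t) (auto simp: zero_in_lengths intro: lengths_add)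

lemma lengths_nonempty_iff:
  assumes "finite G"
  shows "lengths G x \<noteq> {} \<longleftrightarrow> x \<in> generated G"
proof
  assume "lengths G x \<noteq> {}"
  then obtain a where "(\<Sum>g\<in>G. a g * g) = x" by (auto simp: lengths_def)
  moreover have "(\<Sum>g\<in>G. a g * g) \<in> generated G"
    using subset_generated[of G] submonoid_nat_generated[of G]
    by (intro submonoid_nat_sum submonoid_nat_mult) auto
  ultimately show "x \<in> generated G" by simp
next
  have "submonoid_nat {x. lengths G x \<noteq> {}}"
    using zero_in_lengths lengths_add unfolding submonoid_nat_def by blast
  moreover have "1 \<in> lengths G g" if "g \<in> G" for g
    using that assms
    by (intro lengthsI[where a = "\<lambda>h. if h = g then 1 else 0"])
       (simp_all add: if_distrib[of "\<lambda>c. c * _"] cong: if_cong)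
  then have "G \<subseteq> {x. lengths G x \<noteq> {}}" by blast
  ultimately have "generated G \<subseteq> {x. lengths G x \<noteq> {}}" by (intro generated_least)
  then show "x \<in> generated G \<Longrightarrow> lengths G x \<noteq> {}" by blast
qed

text \<open>Every generator is at least 1, so a length of \<open>x\<close> is at most
  \<open>x\<close>. This makes the \<open>Max\<close> in \<open>ord_sg\<close> meaningful.\<close>

lemma finite_lengths:
  assumes "0 \<notin> G"
  shows "finite (lengths G x)"
proof -
  have "(\<Sum>g\<in>G. a g) \<le> (\<Sum>g\<in>G. a g * g)" for a :: "nat \<Rightarrow> nat"
    by (rule sum_mono) (use assms in \<open>metis mult_le_mono2 mult.right_neutral less_one not_le\<close>)
  then have "lengths G x \<subseteq> {..x}" by (auto simp: lengths_def)
  then show ?thesis by (rule finite_subset) simp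
qed

lemma lengths_min_gens: "lengths (min_gens H) x = fact_length H ` factorizations H x"
proof (intro equalityI subsetI)
  fix l assume "l \<in> lengths (min_gens H) x"
  then obtain a where "(\<Sum>g\<in>min_gens H. a g * g) = x" "(\<Sum>g\<in>min_gens H. a g) = l"
    by (auto simp: lengths_def)
  then show "l \<in> fact_length H ` factorizations H x"
    by (intro image_eqI[where x = "restrict a (min_gens H)"])
       (auto simp: fact_length_def factorizations_def)
qed (auto simp: lengths_def fact_length_def factorizations_def)

text \<open>The exception for \<open>x = 0\<close> disappears: without the generator 0, the only
  possible length of 0 is 0.\<close>

lemma homogeneous_iff_lengths:
  assumes "min_gens H = G" "finite G" "0 \<notin> G"
  shows "homogeneous H T \<longleftrightarrow> (\<forall>x\<in>T. \<forall>l\<in>lengths G x. \<forall>l'\<in>lengths G x. l = l')"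
proof -
  have "lengths G 0 \<subseteq> {0}" using assms by (force simp: lengths_def)
  then have zero: "\<forall>l\<in>lengths G 0. \<forall>l'\<in>lengths G 0. l = l'" by blast
  have "homogeneous H T \<longleftrightarrow>
      (\<forall>x\<in>T. x \<noteq> 0 \<longrightarrow> (\<forall>l\<in>lengths G x. \<forall>l'\<in>lengths G x. l = l'))"
    unfolding homogeneous_def lengths_min_gens[of H, unfolded assms(1)] by blast
  with zero show ?thesis by metis
qed

text \<open>The maximum of a finite nonempty set is attained.\<close>

lemma ord_sg_in_lengths:
  assumes "min_gens H = G" "generated G = H" "finite G" "0 \<notin> G" "x \<in> H"
  shows "ord_sg H x \<in> lengths G x"
  using assms lengths_nonempty_iff[of G x] finite_lengths[of G x]
  unfolding ord_sg_def lengths_min_gens[of H, symmetric] by auto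

section \<open>Gluings\<close>

lemma AP_iff: "x \<in> AP H y \<longleftrightarrow> x \<in> H \<and> (\<forall>w\<in>H. x \<noteq> w + y)"
proof -
  have "int x - int y = int w \<longleftrightarrow> x = w + y" for w by linarith
  then show ?thesis by (auto simp: AP_def image_iff)
qed

lemma coprime_combination_cases [consumes 4]:
  fixes p q :: nat
  assumes "coprime p q" "p > 0" "q > 0" and eq: "q * x + p * y = q * x' + p * y'"
  obtains (left) t where "x' = x + t * p" "y = y' + t * q"
  | (right) t where "x = x' + t * p" "y' = y + t * q"
proof -
  \<comment> \<open>It suffices to treat one order of the first components: \<open>p\<close> divides
    \<open>q * (v - u)\<close>, hence \<open>v - u\<close>. The other order follows by swapping the
    representations.\<close>
  have *: "\<exists>t. v = u + t * p \<and> w = z + t * q"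
    if e: "q * u + p * w = q * v + p * z" and "u \<le> v" for u v w z :: nat
  proof -
    obtain c where c: "v = u + c" using \<open>u \<le> v\<close> le_iff_add by blast
    with e have e': "p * w = q * c + p * z" by (simp add: algebra_simps)
    then have "p dvd q * c" by (metis dvd_add_left_iff dvd_triv_left)
    with \<open>coprime p q\<close> obtain t where t: "c = p * t" by (auto simp: coprime_dvd_mult_right_iff)
    with e' have "p * w = p * (z + t * q)" by (simp add: algebra_simps)
    with \<open>p > 0\<close> have "w = z + t * q" by simp
    with c t show ?thesis by (auto simp: mult.commute)
  qed
  show thesis
    using *[of x y x' y'] *[of x' y' x y] eq that nat_le_linear by metis
qed

text \<open>If \<open>t > 0\<close>, then \<open>m = (w + (t - 1) * p) + p\<close> with nonzero
  \<open>p\<close>, so the atom \<open>m\<close> would equal \<open>p\<close>, which is not an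
  atom.\<close>

lemma atom_eq_multiple:
  assumes H: "submonoid_nat H" and m: "m \<in> atoms H" and p: "p \<in> H" "p > 0" "p \<notin> atoms H"
    and "w \<in> H" and eq: "m = w + t * p"
  shows "t = 0"
proof (rule ccontr)
  assume "t \<noteq> 0"
  then obtain t' where t: "t = Suc t'" by (cases t) auto
  have "w + t' * p \<in> H" using assms by (intro submonoid_natD submonoid_nat_mult)
  moreover have sum: "m = (w + t' * p) + p" using eq t by simp
  ultimately have "w + t' * p = 0 \<or> p = 0" using atomsD[OF m _ p(1)] by blast
  then show False using sum p m by auto
qed

text \<open>A description without generators, symmetric under swapping the two components, so that
  one argument serves both.\<close>

definition gluing :: "nat \<Rightarrow> nat \<Rightarrow> nat set \<Rightarrow> nat set \<Rightarrow> nat set" where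
  "gluing p q S1 S2 = {q * x + p * y | x y. x \<in> S1 \<and> y \<in> S2}"

lemma gluing_commute: "gluing p q S1 S2 = gluing q p S2 S1"
  unfolding gluing_def by (auto; metis add.commute)

text \<open>Compare a splitting of \<open>q * m\<close> with the representation
  \<open>q * m + p * 0\<close>. A nontrivial trade would write \<open>m\<close> as
  \<open>w + t * p\<close> with \<open>t > 0\<close>, which is impossible, so the splitting happens
  inside \<open>S1\<close>.\<close>

lemma scaled_atom_in_atoms_gluing:
  assumes S1: "submonoid_nat S1" and S2: "submonoid_nat S2"
    and pq: "coprime p q" "p > 0" "q > 0" and p: "p \<in> S1" "p \<notin> atoms S1"
    and m: "m \<in> atoms S1"
  shows "q * m \<in> atoms (gluing p q S1 S2)"
proof -
  have mem: "m \<in> S1" "m \<noteq> 0" using m by (auto simp: atoms_def)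
  have "q * m \<in> gluing p q S1 S2"
    using mem submonoid_natD[OF S2] unfolding gluing_def by (force intro: exI[of _ 0])
  moreover have "u = 0 \<or> v = 0"
    if u: "u \<in> gluing p q S1 S2" and v: "v \<in> gluing p q S1 S2" and eq: "q * m = u + v" for u v
  proof -
    obtain x y x' y' where uv: "x \<in> S1" "y \<in> S2" "u = q * x + p * y"
        "x' \<in> S1" "y' \<in> S2" "v = q * x' + p * y'"
      using u v unfolding gluing_def by blast
    have xx: "x + x' \<in> S1" using uv S1 by (intro submonoid_natD)
    have "q * m + p * 0 = q * (x + x') + p * (y + y')"
      using eq uv by (simp add: algebra_simps)
    with pq have "m = x + x' \<and> y = 0 \<and> y' = 0"
    proof (cases rule: coprime_combination_cases)
      case (left t)
      then show ?thesis using \<open>q > 0\<close> by simp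
    next
      case (right t)
      then show ?thesis using atom_eq_multiple[OF S1 m p(1) pq(2) p(2) xx, of t] by auto
    qed
    then show ?thesis using atomsD[OF m, of x x'] uv by auto
  qed
  ultimately show ?thesis using mem pq unfolding atoms_def by auto
qed

text \<open>A common element \<open>q * m = p * j\<close> would make the atom \<open>m\<close> a
  multiple of \<open>p\<close>.\<close>

lemma scaled_atoms_disjoint:
  assumes S1: "submonoid_nat S1"
    and pq: "coprime p q" "p > 0" "q > 0" and p: "p \<in> S1" "p \<notin> atoms S1"
  shows "(*) q ` atoms S1 \<inter> (*) p ` N = {}"
proof -
  have False if m: "m \<in> atoms S1" and eq: "q * m = p * j" for m j
  proof -
    have "q * m + p * 0 = q * 0 + p * j" using eq by simp
    with pq show False
    proof (cases rule: coprime_combination_cases)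
      case (left t)
      then show False using m by (simp add: atoms_def)
    next
      case (right t)
      then have "t = 0"
        using atom_eq_multiple[OF S1 m p(1) pq(2) p(2), of 0] submonoid_natD[OF S1] by auto
      then show False using right m by (simp add: atoms_def)
    qed
  qed
  then show ?thesis by blast
qed

text \<open>By disjointness, a coefficient vector on the union is a pair of vectors on
  \<open>A\<close> and \<open>B\<close>.\<close>

lemma lengths_scaled_Un:
  fixes p q :: nat
  assumes fin: "finite A" "finite B" and pos: "p > 0" "q > 0"
    and disj: "(*) q ` A \<inter> (*) p ` B = {}"
  shows "l \<in> lengths ((*) q ` A \<union> (*) p ` B) z \<longleftrightarrow>
    (\<exists>x y l1 l2. z = q * x + p * y \<and> l = l1 + l2 \<and> l1 \<in> lengths A x \<and> l2 \<in> lengths B y)"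
    (is "?L \<longleftrightarrow> ?R")
proof -
  have sums: "sum f ((*) q ` A \<union> (*) p ` B) = (\<Sum>m\<in>A. f (q * m)) + (\<Sum>m\<in>B. f (p * m))"
    for f :: "nat \<Rightarrow> nat"
    using fin pos by (simp add: sum.union_disjoint[OF _ _ disj] sum.reindex inj_on_def)
  show ?thesis
  proof
    assume ?L
    then obtain c where c: "(\<Sum>g\<in>(*) q ` A \<union> (*) p ` B. c g * g) = z"
        "(\<Sum>g\<in>(*) q ` A \<union> (*) p ` B. c g) = l"
      by (auto simp: lengths_def)
    have "z = q * (\<Sum>m\<in>A. c (q * m) * m) + p * (\<Sum>m\<in>B. c (p * m) * m)"
      using c(1) unfolding sums by (simp add: sum_distrib_left algebra_simps)
    moreover have "l = (\<Sum>m\<in>A. c (q * m)) + (\<Sum>m\<in>B. c (p * m))"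
      using c(2) unfolding sums by simp
    moreover have "(\<Sum>m\<in>A. c (q * m)) \<in> lengths A (\<Sum>m\<in>A. c (q * m) * m)"
      by (rule lengthsI[where a = "\<lambda>m. c (q * m)"]) simp_all
    moreover have "(\<Sum>m\<in>B. c (p * m)) \<in> lengths B (\<Sum>m\<in>B. c (p * m) * m)"
      by (rule lengthsI[where a = "\<lambda>m. c (p * m)"]) simp_all
    ultimately show ?R by blast
  next
    assume ?R
    then obtain a b where ab:
        "z = q * (\<Sum>m\<in>A. a m * m) + p * (\<Sum>m\<in>B. b m * m)" "l = (\<Sum>m\<in>A. a m) + (\<Sum>m\<in>B. b m)"
      by (auto simp: lengths_def)
    \<comment> \<open>Division undoes the scaling; disjointness sends all of \<open>p * B\<close> to
      the second branch.\<close>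
    define c where "c g = (if g \<in> (*) q ` A then a (g div q) else b (g div p))" for g
    have cA: "c (q * m) = a m" if "m \<in> A" for m
      using that pos by (simp add: c_def)
    have cB: "c (p * m) = b m" if "m \<in> B" for m
      using that pos disj by (auto simp: c_def)
    show ?L
      by (rule lengthsI[where a = c]; unfold sums)
         (simp_all add: ab cA cB sum_distrib_left mult.left_commute)
  qed
qed

theorem theorem5p7:
  fixes S1 S2 S :: "nat set" and gm gn :: "nat \<Rightarrow> nat" and d k p q s n :: nat
  assumes "numerical_semigroup S1" and "numerical_semigroup S2"
    and "strict_mono_on {1..d} gm" and "minimally_generates (gm ` {1..d}) S1"
    and "strict_mono_on {1..k} gn" and "minimally_generates (gn ` {1..k}) S2"
    and "p \<in> S1" and "q \<in> S2" and "p > 0" and "q > 0" and "gcd p q = 1"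
    and "p \<notin> gm ` {1..d}" and "q \<notin> gn ` {1..k}"
    and "S = generated ((\<lambda>i. q * gm i) ` {1..d} \<union> (\<lambda>j. p * gn j) ` {1..k})"
    and "s \<in> S1"
    and "n = (LEAST n. n * p \<notin> AP S1 s)"
  shows "homogeneous S (AP S (q * s)) \<longleftrightarrow>
    homogeneous S1 (AP S1 s) \<and> homogeneous S2 (AP S2 (n * q)) \<and>
    (n > 1 \<longrightarrow> ord_sg S1 p = ord_sg S2 q)"
proof -

  \<comment> \<open>Minimal generators and lengths of the gluing\<close>
  define A B where "A = atoms S1" and "B = atoms S2"
  define G where "G = (*) q ` A \<union> (*) p ` B"
  have S1: "submonoid_nat S1" and S2: "submonoid_nat S2"
    using assms(1,2) by (auto simp: numerical_semigroup_def)
  note S1D = submonoid_natD[OF S1] and S2D = submonoid_natD[OF S2]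
  have gmA: "gm ` {1..d} = A" and gnB: "gn ` {1..k} = B"
    using assms(4,6) by (simp_all add: minimally_generates_imp_atoms A_def B_def)
  then have fin: "finite A" "finite B" by (metis finite_imageI finite_atLeastAtMost)+
  have genA: "generated A = S1" and genB: "generated B = S2"
    using S1 S2 by (simp_all add: A_def B_def generated_atoms)
  have mgA: "min_gens S1 = A" and mgB: "min_gens S2 = B"
    using assms(4,6) min_gens_eq gmA gnB by auto
  have "coprime p q" using assms(11) by (simp add: coprime_iff_gcd_eq_1)
  note pq = this \<open>p > 0\<close> \<open>q > 0\<close>
  have qp: "coprime q p" using pq by (simp add: coprime_commute)
  have pA: "p \<notin> A" and qB: "q \<notin> B" using assms(12,13) gmA gnB by auto
  have nz: "0 \<notin> A" "0 \<notin> B" by (auto simp: A_def B_def atoms_def)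
  then have nzG: "0 \<notin> G" using pq by (auto simp: G_def)
  have finG: "finite G" using fin by (simp add: G_def)
  have disj: "(*) q ` A \<inter> (*) p ` B = {}"
    using scaled_atoms_disjoint[OF S1 pq \<open>p \<in> S1\<close>] pA by (simp add: A_def)
  note lenG = lengths_scaled_Un[OF fin pq(2,3) disj, folded G_def]
  have lenA: "lengths A x \<noteq> {} \<longleftrightarrow> x \<in> S1" and lenB: "lengths B x \<noteq> {} \<longleftrightarrow> x \<in> S2" for x
    using lengths_nonempty_iff fin genA genB by auto
  have genG: "generated G = S"
    using assms(14) by (simp add: G_def gmA[symmetric] gnB[symmetric] image_image)
  \<comment> \<open>Membership means having a length, and \<open>lenG\<close> splits lengths; this
    identifies \<open>S\<close> with the gluing.\<close>
  have "z \<in> S \<longleftrightarrow> (\<exists>l. l \<in> lengths G z)" for z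
    using lengths_nonempty_iff[OF finG, of z] genG by blast
  moreover have "(\<exists>l. l \<in> lengths G z) \<longleftrightarrow>
      (\<exists>x y. z = q * x + p * y \<and> lengths A x \<noteq> {} \<and> lengths B y \<noteq> {})" for z
    unfolding lenG by blast
  ultimately have S_eq: "S = gluing p q S1 S2"
    by (auto simp: lenA lenB gluing_def)
  have "q * m \<in> atoms S" if "m \<in> A" for m
    using scaled_atom_in_atoms_gluing[OF S1 S2 pq \<open>p \<in> S1\<close>] pA that by (simp add: A_def S_eq)
  moreover have "p * m \<in> atoms S" if "m \<in> B" for m
    using scaled_atom_in_atoms_gluing[OF S2 S1 qp pq(3,2) \<open>q \<in> S2\<close>] qB that
    by (simp add: B_def S_eq gluing_commute[of p])
  ultimately have "G \<subseteq> atoms S" by (auto simp: G_def)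
  then have mgG: "min_gens S = G" using genG by (intro min_gens_eq minimally_generatesI_atoms)
  note homS1 = homogeneous_iff_lengths[OF mgA fin(1) nz(1)]
    and homS2 = homogeneous_iff_lengths[OF mgB fin(2) nz(2)]
    and homS = homogeneous_iff_lengths[OF mgG finG nzG]
  have ordp: "ord_sg S1 p \<in> lengths A p" and ordq: "ord_sg S2 q \<in> lengths B q"
    using ord_sg_in_lengths mgA mgB genA genB fin nz assms(7,8) by auto
  have S_mem: "q * x + p * y \<in> S" if "x \<in> S1" "y \<in> S2" for x y
    using that by (auto simp: S_eq gluing_def)
  have S_cases: "\<exists>x\<in>S1. \<exists>y\<in>S2. z = q * x + p * y" if "z \<in> S" for z
    using that by (auto simp: S_eq gluing_def)

  \<comment> \<open>Multiples of \<open>p\<close> in the Apery set: \<open>t * p\<close> lies in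
    \<open>AP S1 s\<close> exactly for \<open>t < n\<close>\<close>
  have pt: "t * p \<in> S1" and qt: "t * q \<in> S2" for t
    using submonoid_nat_mult S1 S2 assms(7,8) by auto
  \<comment> \<open>Some multiple of \<open>p\<close> lies outside, so the \<open>LEAST\<close>
    defining \<open>n\<close> is attained.\<close>
  have ex: "s * p \<notin> AP S1 s"
  proof -
    have "s * p = s * (p - 1) + s" using \<open>p > 0\<close> by (cases p) auto
    moreover have "s * (p - 1) \<in> S1"
      using submonoid_nat_mult[OF S1 \<open>s \<in> S1\<close>, of "p - 1"] by (simp add: mult.commute)
    ultimately show ?thesis by (auto simp: AP_iff)
  qed
  have "n * p \<notin> AP S1 s" unfolding assms(16) using ex by (rule LeastI)
  then obtain w0 where w0: "w0 \<in> S1" "n * p = w0 + s" using pt by (auto simp: AP_iff)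
  have below_n: "t * p \<in> AP S1 s" if "t < n" for t
    using that not_less_Least unfolding assms(16) by blast
  have at_most_n: "t < n" if "t * p \<in> AP S1 s" for t
  proof (rule ccontr)
    assume "\<not> t < n"
    then obtain c where "t = n + c" by (metis le_iff_add not_le)
    then have "t * p = (w0 + c * p) + s" using w0 by (simp add: algebra_simps)
    then show False using that w0 pt S1D by (auto simp: AP_iff)
  qed
  have embed1: "q * x \<in> AP S (q * s)" if x: "x \<in> AP S1 s" for x
    unfolding AP_iff
  proof (intro conjI ballI notI)
    show "q * x \<in> S" using S_mem[of x 0] x S2D by (simp add: AP_iff)
    fix w assume "w \<in> S" "q * x = w + q * s"
    then obtain u y where u: "u \<in> S1" "y \<in> S2" "w = q * u + p * y"
      using S_cases by blast
    with \<open>q * x = w + q * s\<close> have "q * x + p * 0 = q * (u + s) + p * y"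
      by (simp add: algebra_simps)
    with pq obtain t where "x = (u + t * p) + s"
    proof (cases rule: coprime_combination_cases)
      case (left t)
      \<comment> \<open>Here \<open>0 = y + t * q\<close> forces the trade to be trivial, whence the
        witness 0.\<close>
      then show ?thesis using that[of 0] \<open>q > 0\<close> by simp
    next
      case (right t)
      then show ?thesis using that[of t] by simp
    qed
    then show False using x u pt S1D by (auto simp: AP_iff)
  qed
  have embed2: "p * y \<in> AP S (q * s)" if y: "y \<in> AP S2 (n * q)" for y
    unfolding AP_iff
  proof (intro conjI ballI notI)
    show "p * y \<in> S" using S_mem[of 0 y] y S1D by (simp add: AP_iff)
    fix w assume "w \<in> S" "p * y = w + q * s"
    then obtain u v where u: "u \<in> S1" "v \<in> S2" "w = q * u + p * v"
      using S_cases by blast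
    with \<open>p * y = w + q * s\<close> have "q * 0 + p * y = q * (u + s) + p * v"
      by (simp add: algebra_simps)
    with pq obtain t where t: "u + s = t * p" "y = v + t * q"
    proof (cases rule: coprime_combination_cases)
      case (left t)
      then show ?thesis using that[of t] by simp
    next
      case (right t)
      then show ?thesis using that[of 0] \<open>p > 0\<close> by simp
    qed
    \<comment> \<open>Taking \<open>q * s\<close> out of \<open>p * y\<close> costs a trade of at
      least \<open>n\<close> copies of \<open>q\<close>; this is where \<open>n * q\<close> comes
      from.\<close>
    then have "t * p \<notin> AP S1 s" using u(1) unfolding AP_iff by metis
    then have "\<not> t < n" using below_n by blast
    then obtain c where "t = n + c" by (metis le_iff_add not_le)
    then have "y = (v + c * q) + n * q" using t by (simp add: algebra_simps)
    then show False using y u qt S2D by (auto simp: AP_iff)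
  qed
  show ?thesis
  proof (intro iffI conjI impI)
    assume hom: "homogeneous S (AP S (q * s))"
    have lenG1: "l \<in> lengths G (q * x)" if "l \<in> lengths A x" for l x
      unfolding lenG using that zero_in_lengths by (metis add_0_right mult_0_right)
    have lenG2: "l \<in> lengths G (p * y)" if "l \<in> lengths B y" for l y
      unfolding lenG using that zero_in_lengths by (metis add_0 mult_0_right)
    show "homogeneous S1 (AP S1 s)"
      using hom embed1 lenG1 unfolding homS homS1 by blast
    show "homogeneous S2 (AP S2 (n * q))"
      using hom embed2 lenG2 unfolding homS homS2 by blast
    assume "n > 1"
    \<comment> \<open>The element \<open>q * p\<close> inherits lengths both from \<open>p\<close>
      in \<open>S1\<close> and from \<open>q\<close> in \<open>S2\<close>.\<close>
    then have "q * p \<in> AP S (q * s)" using below_n[of 1] embed1 by simp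
    moreover have "ord_sg S2 q \<in> lengths G (q * p)"
      using lenG2[OF ordq] by (simp add: mult.commute)
    ultimately show "ord_sg S1 p = ord_sg S2 q"
      using hom lenG1[OF ordp] unfolding homS by blast
  next
    assume R: "homogeneous S1 (AP S1 s) \<and> homogeneous S2 (AP S2 (n * q)) \<and>
      (n > 1 \<longrightarrow> ord_sg S1 p = ord_sg S2 q)"
    then have hom1: "l = l'" if "x \<in> AP S1 s" "l \<in> lengths A x" "l' \<in> lengths A x" for x l l'
      using that unfolding homS1 by blast
    from R have hom2: "l = l'"
      if "x \<in> AP S2 (n * q)" "l \<in> lengths B x" "l' \<in> lengths B x" for x l l'
      using that unfolding homS2 by blast
    have comps: "x \<in> AP S1 s" "y \<in> AP S2 (n * q)"
      if z: "q * x + p * y \<in> AP S (q * s)" and xy: "x \<in> S1" "y \<in> S2" for x y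
    proof -
      have False if "w \<in> S1" "x = w + s" for w
      proof -
        have "q * x + p * y = (q * w + p * y) + q * s" using that by (simp add: algebra_simps)
        then show False using z that xy S_mem by (auto simp: AP_iff)
      qed
      then show "x \<in> AP S1 s" using xy by (auto simp: AP_iff)
      have False if "w \<in> S2" "y = w + n * q" for w
      proof -
        \<comment> \<open>The \<open>n\<close> copies of \<open>q\<close> are traded for
          \<open>n * p = w0 + s\<close>, which exposes the summand \<open>q * s\<close>.\<close>
        have "q * x + p * y = q * x + p * w + q * (n * p)"
          using that by (simp add: algebra_simps)
        also have "\<dots> = (q * (x + w0) + p * w) + q * s"
          unfolding w0(2) by (simp add: algebra_simps)
        finally show False using z that xy w0 S1D S_mem by (auto simp: AP_iff)
      qed
      then show "y \<in> AP S2 (n * q)" using xy by (auto simp: AP_iff)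
    qed
    have trade: "l1 + l2 = l1' + l2'"
      if z: "q * x + p * y \<in> AP S (q * s)" "q * x' + p * y' \<in> AP S (q * s)"
        and l: "l1 \<in> lengths A x" "l2 \<in> lengths B y" "l1' \<in> lengths A x'" "l2' \<in> lengths B y'"
        and t: "x' = x + t * p" "y = y' + t * q"
      for x y x' y' l1 l2 l1' l2' t
    proof -
      have mem: "x \<in> S1" "x' \<in> S1" "y \<in> S2" "y' \<in> S2" using l lenA lenB by blast+
      have x': "x' \<in> AP S1 s" and y: "y \<in> AP S2 (n * q)" using comps z mem by blast+
      \<comment> \<open>A summand in \<open>S1\<close> of an element of \<open>AP S1 s\<close> again
        lies in \<open>AP S1 s\<close>; applied to \<open>t * p\<close>, this bounds
        \<open>t\<close>.\<close>
      have "x' = (x + w) + s" if "t * p = w + s" for w using t that by simp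
      then have "t * p \<in> AP S1 s" using x' mem pt S1D unfolding AP_iff by metis
      then have "t < n" by (rule at_most_n)
      \<comment> \<open>For \<open>n \<le> 1\<close> the bound \<open>t < n\<close> leaves only
        \<open>t = 0\<close>, so equal orders matter only for \<open>n > 1\<close>.\<close>
      then have e: "t * ord_sg S1 p = t * ord_sg S2 q" using R by (cases "n > 1") auto
      \<comment> \<open>Both sides are lengths of \<open>x' = x + t * p\<close>, and homogeneity
        identifies them.\<close>
      have "l1' = l1 + t * ord_sg S1 p"
        using hom1[OF x' l(3)] lengths_add[OF l(1) lengths_mult[OF ordp, of t]] t by blast
      moreover have "l2 = l2' + t * ord_sg S2 q"
        using hom2[OF y l(2)] lengths_add[OF l(4) lengths_mult[OF ordq, of t]] t by blast
      ultimately show ?thesis using e by simp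
    qed
    show "homogeneous S (AP S (q * s))"
      unfolding homS
    proof (intro ballI)
      fix z l l' assume z: "z \<in> AP S (q * s)" and "l \<in> lengths G z" "l' \<in> lengths G z"
      then obtain x y l1 l2 x' y' l1' l2' where
        r: "z = q * x + p * y" "l = l1 + l2" "l1 \<in> lengths A x" "l2 \<in> lengths B y" and
        r': "z = q * x' + p * y'" "l' = l1' + l2'" "l1' \<in> lengths A x'" "l2' \<in> lengths B y'"
        unfolding lenG by blast
      have zr: "q * x + p * y \<in> AP S (q * s)" "q * x' + p * y' \<in> AP S (q * s)"
        using z r(1) r'(1) by simp_all
      have "q * x + p * y = q * x' + p * y'" using r(1) r'(1) by simp
      with pq show "l = l'"
      proof (cases rule: coprime_combination_cases)
        case (left t)
        then show ?thesis using trade[OF zr r(3,4) r'(3,4) left] r(2) r'(2) by simp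
      next
        case (right t)
        then show ?thesis using trade[OF zr(2,1) r'(3,4) r(3,4) right] r(2) r'(2) by simp
      qed
    qed
  qed
qed

end
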